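(* Let $f$ be either the Liouville function $\lambda$ or the Möbius function $\mu$. Then, as $n \to \infty$, $$M[f(i)f(j)] - M[f(i)]\,M[f(j)] = O(1/n),$$ where, for $n \ge 2$, $M[\cdot]$ denotes the average value over indices in $\{1,\dots,n\}$, that is, $$M[f(i)] = M[f(j)] = \frac{1}{n}\sum_{k=1}^{n} f(k), \qquad M[f(i)f(j)] = \frac{1}{n(n-1)}\sum_{\substack{1\le i,j\le n\\ i\ne j}} f(i)f(j).$$
   Context: For a positive integer $k$, $\lambda(k) = (-1)^{\nu(k)}$, where $\nu(k)$ is the number of prime factors of $k$ counted with multiplicity. The Möbius function is $\mu(k) = 1$ if $k$ is squarefree with an even number of prime factors (in particular $\mu(1)=1$), $\mu(k) = -1$ if $k$ is squarefree with an odd number of prime factors, and $\mu(k)=0$ if $k$ is not squarefree. The average of the product is taken over ordered pairs of distinct indices. *)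

theory Defs
  imports
    "HOL-Number_Theory.Number_Theory"
    "HOL-Computational_Algebra.Squarefree"
    "HOL-Library.Landau_Symbols"
begin

(* Real-valued; the arguments of interest are positive, and the value at 0 is never used. *)

definition liouville :: "nat \<Rightarrow> real" where
  "liouville k = (-1) ^ size (prime_factorization k)"

definition moebius :: "nat \<Rightarrow> real" where
  "moebius k = (if squarefree k then (-1) ^ card (prime_factors k) else 0)"

definition mean :: "nat \<Rightarrow> (nat \<Rightarrow> real) \<Rightarrow> real" where
  "mean n g = (\<Sum>k=1..n. g k) / real n"

(* Average over ordered pairs of distinct indices; meant for n at least 2. *)
definition pair_mean :: "nat \<Rightarrow> (nat \<Rightarrow> nat \<Rightarrow> real) \<Rightarrow> real" where
  "pair_mean n h =
     (\<Sum>(i, j) \<in> {(i, j). i \<in> {1..n} \<and> j \<in> {1..n} \<and> i \<noteq> j}. h i j)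
       / (real n * (real n - 1))"

end

theory Submission
  imports Defs
begin

text \<open>
  The arithmetic of \<open>f\<close> enters only through the bound \<open>\<bar>f k\<bar> \<le> 1\<close>. Write \<open>S\<close> for the sum and
  \<open>Q\<close> for the sum of squares of \<open>f\<close> over \<open>{1..n}\<close>. All ordered pairs together contribute \<open>S\<^sup>2\<close>
  and the diagonal contributes \<open>Q\<close>, so the quantity in question is
  \<open>(S\<^sup>2 - Q) / (n (n - 1)) - S\<^sup>2 / n\<^sup>2 = (S\<^sup>2 / n - Q) / (n (n - 1))\<close>: the only correlation
  between two distinct indices is the one caused by drawing without replacement
  (lemma \<open>pair_mean_minus_mean_squared\<close>). Both \<open>S\<^sup>2 / n\<close> and \<open>Q\<close> lie in \<open>[0, n]\<close>, hence the
  quantity is at most \<open>1 / (n - 1) \<le> 2 / n\<close> in absolute value.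
\<close>

lemma abs_liouville_le_1: "\<bar>liouville k\<bar> \<le> 1"
  by (simp add: liouville_def power_abs)

lemma abs_moebius_le_1: "\<bar>moebius k\<bar> \<le> 1"
  by (simp add: moebius_def power_abs)

lemma sum_off_diagonal_product:
  fixes f :: "'a \<Rightarrow> 'b::comm_ring_1"
  assumes "finite A"
  shows "(\<Sum>(i, j) \<in> {(i, j). i \<in> A \<and> j \<in> A \<and> i \<noteq> j}. f i * f j)
           = (\<Sum>k\<in>A. f k)\<^sup>2 - (\<Sum>k\<in>A. (f k)\<^sup>2)"
proof -
  have off: "{(i, j). i \<in> A \<and> j \<in> A \<and> i \<noteq> j} = A \<times> A - (\<lambda>k. (k, k)) ` A"
    by auto
  have "(\<Sum>(i, j) \<in> A \<times> A - (\<lambda>k. (k, k)) ` A. f i * f j)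
          = (\<Sum>(i, j) \<in> A \<times> A. f i * f j) - (\<Sum>(i, j) \<in> (\<lambda>k. (k, k)) ` A. f i * f j)"
    using assms by (intro sum_diff) auto
  also have "(\<Sum>(i, j) \<in> A \<times> A. f i * f j) = (\<Sum>k\<in>A. f k)\<^sup>2"
    by (simp add: power2_eq_square sum_product sum.cartesian_product)
  also have "(\<Sum>(i, j) \<in> (\<lambda>k. (k, k)) ` A. f i * f j) = (\<Sum>k\<in>A. (f k)\<^sup>2)"
    by (subst sum.reindex) (auto simp: inj_on_def power2_eq_square)
  finally show ?thesis
    by (simp only: off)
qed

text \<open>
  Up to the factor \<open>- 1 / (n - 1)\<close> the right-hand side is the variance of \<open>f\<close> on \<open>{1..n}\<close>; this
  is the classical covariance of two draws without replacement.
\<close>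
lemma pair_mean_minus_mean_squared:
  assumes "n \<ge> 2"
  shows "pair_mean n (\<lambda>i j. f i * f j) - mean n f * mean n f
           = ((\<Sum>k=1..n. f k)\<^sup>2 / real n - (\<Sum>k=1..n. (f k)\<^sup>2)) / (real n * (real n - 1))"
proof -
  have "real n \<noteq> 0" "real n - 1 \<noteq> 0"
    using assms by auto
  then show ?thesis
    unfolding pair_mean_def mean_def sum_off_diagonal_product[OF finite_atLeastAtMost]
    by (simp add: divide_simps power2_eq_square) (simp add: algebra_simps)
qed

lemma abs_pair_mean_minus_mean_squared_le:
  assumes bound: "\<And>k. \<bar>f k\<bar> \<le> 1" and n: "n \<ge> 2"
  shows "\<bar>pair_mean n (\<lambda>i j. f i * f j) - mean n f * mean n f\<bar> \<le> 1 / (real n - 1)"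
proof -
  define S where "S = (\<Sum>k=1..n. f k)"
  define Q where "Q = (\<Sum>k=1..n. (f k)\<^sup>2)"
  have "\<bar>S\<bar> \<le> (\<Sum>k=1..n. \<bar>f k\<bar>)"
    unfolding S_def by (rule sum_abs)
  also have "\<dots> \<le> real n"
    using sum_bounded_above[of "{1..n}" "\<lambda>k. \<bar>f k\<bar>" 1] bound by simp
  finally have "S\<^sup>2 \<le> (real n)\<^sup>2"
    by (simp add: abs_le_square_iff[symmetric])
  then have S: "0 \<le> S\<^sup>2 / real n" "S\<^sup>2 / real n \<le> real n"
    using n by (auto simp: field_simps power2_eq_square)
  have "(f k)\<^sup>2 \<le> 1" for k
    using bound[of k] by (simp add: abs_square_le_1)
  then have Q: "0 \<le> Q" "Q \<le> real n"
    using sum_bounded_above[of "{1..n}" "\<lambda>k. (f k)\<^sup>2" 1] by (auto simp: Q_def sum_nonneg)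
  have diff: "\<bar>S\<^sup>2 / real n - Q\<bar> \<le> real n"
    using S Q by linarith
  have "\<bar>S\<^sup>2 / real n - Q\<bar> / (real n * (real n - 1)) \<le> real n / (real n * (real n - 1))"
    using diff n by (intro divide_right_mono) auto
  also have "\<dots> = 1 / (real n - 1)"
    using n by simp
  finally show ?thesis
    using n by (simp add: pair_mean_minus_mean_squared abs_mult S_def Q_def)
qed

theorem theorem1:
  fixes f :: "nat \<Rightarrow> real"
  assumes "f = liouville \<or> f = moebius"
  shows "(\<lambda>n. pair_mean n (\<lambda>i j. f i * f j) - mean n f * mean n f)
           \<in> O[sequentially](\<lambda>n. 1 / real n)"
proof (rule bigoI[where c = 2], rule eventually_sequentiallyI[of 2])
  fix n :: nat
  assume n: "2 \<le> n"
  have "\<bar>f k\<bar> \<le> 1" for k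
    using assms abs_liouville_le_1 abs_moebius_le_1 by auto
  then have "\<bar>pair_mean n (\<lambda>i j. f i * f j) - mean n f * mean n f\<bar> \<le> 1 / (real n - 1)"
    using n by (rule abs_pair_mean_minus_mean_squared_le)
  also have "\<dots> \<le> 2 * (1 / real n)"
    using n by (simp add: field_simps)
  finally show "norm (pair_mean n (\<lambda>i j. f i * f j) - mean n f * mean n f)
                  \<le> 2 * norm (1 / real n)"
    by simp
qed

end
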